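(* Let $X$ be a reflexive Banach space, let $Y$ be a Banach space (both over $\mathbb{K}$), and let $T,A\in\mathcal{K}(X,Y)$. Then $$T\perp_B A\iff 0\in\operatorname{conv}\bigl(\{y^*(Ax)\colon x\in\operatorname{ext}(B_X),\ y^*\in\operatorname{ext}(B_{Y^*}),\ y^*(Tx)=\|T\|\}\bigr).$$
   Context: $\mathbb{K}$ is $\mathbb{R}$ or $\mathbb{C}$. $\mathcal{K}(X,Y)$ is the space of compact linear operators from $X$ to $Y$ with the operator norm. $B_X$, $B_{Y^*}$ are the closed unit balls of $X$, $Y^*$, $\operatorname{ext}$ denotes the set of extreme points and $\operatorname{conv}$ the convex hull. $x\perp_B y$ (Birkhoff-James orthogonality) means $\|x+\lambda y\|\geq\|x\|$ for all $\lambda\in\mathbb{K}$. *)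

theory Defs
  imports "HOL-Analysis.Analysis"
begin

text \<open>
  The scalar field is a type \<open>'k\<close> that is a copy of the real or of the complex numbers: there is a
  norm-preserving embedding of real algebras into \<^typ>\<open>complex\<close> whose range is the real line or
  the whole plane.
\<close>

class real_or_complex = real_normed_field +
  assumes embedding_into_complex:
    "\<exists>\<phi> :: 'a \<Rightarrow> complex.
       (\<forall>x y. \<phi> (x + y) = \<phi> x + \<phi> y) \<and>
       (\<forall>x y. \<phi> (x * y) = \<phi> x * \<phi> y) \<and>
       (\<forall>r x. \<phi> (r *\<^sub>R x) = r *\<^sub>R \<phi> x) \<and>
       (\<forall>x. norm (\<phi> x) = norm x) \<and>
       (range \<phi> = \<real> \<or> range \<phi> = UNIV)"

instance real :: real_or_complex
proof
  show "\<exists>\<phi> :: real \<Rightarrow> complex.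
       (\<forall>x y. \<phi> (x + y) = \<phi> x + \<phi> y) \<and>
       (\<forall>x y. \<phi> (x * y) = \<phi> x * \<phi> y) \<and>
       (\<forall>r x. \<phi> (r *\<^sub>R x) = r *\<^sub>R \<phi> x) \<and>
       (\<forall>x. norm (\<phi> x) = norm x) \<and>
       (range \<phi> = \<real> \<or> range \<phi> = UNIV)"
    by (rule exI[where x = complex_of_real]) (auto simp: Reals_def scaleR_conv_of_real)
qed

instance complex :: real_or_complex
proof
  show "\<exists>\<phi> :: complex \<Rightarrow> complex.
       (\<forall>x y. \<phi> (x + y) = \<phi> x + \<phi> y) \<and>
       (\<forall>x y. \<phi> (x * y) = \<phi> x * \<phi> y) \<and>
       (\<forall>r x. \<phi> (r *\<^sub>R x) = r *\<^sub>R \<phi> x) \<and>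
       (\<forall>x. norm (\<phi> x) = norm x) \<and>
       (range \<phi> = \<real> \<or> range \<phi> = UNIV)"
    by (rule exI[where x = "\<lambda>z. z"]) auto
qed

text \<open>
  A normed space over \<open>'k\<close> is a type of class \<^class>\<open>real_normed_vector\<close> with a scalar
  multiplication by \<open>'k\<close> that extends the given real one. Banach spaces are obtained by taking the
  type in class \<^class>\<open>banach\<close>.
\<close>

locale normed_space_over = vector_space scale
  for scale :: "'k::real_or_complex \<Rightarrow> 'a::real_normed_vector \<Rightarrow> 'a" +
  assumes scale_of_real: "scale (of_real r) x = r *\<^sub>R x"
    and norm_scale: "norm (scale c x) = norm c * norm x"

lemma normed_space_over_scalars:
  "normed_space_over ((*) :: 'k::real_or_complex \<Rightarrow> 'k \<Rightarrow> 'k)"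
  by unfold_locales (auto simp: algebra_simps scaleR_conv_of_real norm_mult)

lemma normed_space_over_scaleR:
  "normed_space_over ((*\<^sub>R) :: real \<Rightarrow> 'a::real_normed_vector \<Rightarrow> 'a)"
  by unfold_locales (auto simp: algebra_simps)

text \<open>
  The type \<open>'a \<Rightarrow>\<^sub>L 'b\<close> consists of the bounded real-linear maps; the operators over \<open>'k\<close> are
  those that are \<open>'k\<close>-linear. Its norm is the operator norm, which depends only on the norms of
  \<open>'a\<close> and \<open>'b\<close>.
\<close>

definition bounded_operators ::
    "('k::real_or_complex \<Rightarrow> 'a::real_normed_vector \<Rightarrow> 'a) \<Rightarrow>
     ('k \<Rightarrow> 'b::real_normed_vector \<Rightarrow> 'b) \<Rightarrow> ('a \<Rightarrow>\<^sub>L 'b) set" where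
  "bounded_operators sa sb = {T. Vector_Spaces.linear sa sb (blinfun_apply T)}"

definition compact_operators ::
    "('k::real_or_complex \<Rightarrow> 'a::real_normed_vector \<Rightarrow> 'a) \<Rightarrow>
     ('k \<Rightarrow> 'b::real_normed_vector \<Rightarrow> 'b) \<Rightarrow> ('a \<Rightarrow>\<^sub>L 'b) set" where
  "compact_operators sa sb =
     {T \<in> bounded_operators sa sb. compact (closure (blinfun_apply T ` cball 0 1))}"

definition operator_scale ::
    "('k \<Rightarrow> 'b \<Rightarrow> 'b) \<Rightarrow> 'k \<Rightarrow> ('a \<Rightarrow>\<^sub>L 'b) \<Rightarrow> ('a::real_normed_vector \<Rightarrow>\<^sub>L 'b::real_normed_vector)" where
  "operator_scale sb c T = Blinfun (\<lambda>x. sb c (blinfun_apply T x))"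

context normed_space_over
begin

lemma bounded_linear_scale: "bounded_linear (scale c)"
proof
  show "scale c (x + y) = scale c x + scale c y" for x y
    by (rule scale_right_distrib)
  show "scale c (r *\<^sub>R x) = r *\<^sub>R scale c x" for r x
    by (simp flip: scale_of_real add: mult.commute)
  show "\<exists>K. \<forall>x. norm (scale c x) \<le> norm x * K"
    by (rule exI[where x = "norm c"]) (simp add: norm_scale mult.commute)
qed

lemma operator_scale_apply: "blinfun_apply (operator_scale scale c T) x = scale c (T x)"
  unfolding operator_scale_def
  by (subst bounded_linear_Blinfun_apply)
    (auto intro: bounded_linear_compose[OF bounded_linear_scale blinfun.bounded_linear_right])

lemma norm_operator_scale: "norm (operator_scale scale c T) = norm c * norm T"
proof -
  have "norm (operator_scale scale c T) = onorm (\<lambda>x. norm c *\<^sub>R T x)"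
    by (simp add: norm_blinfun.rep_eq onorm_def operator_scale_apply norm_scale)
  also have "\<dots> = norm c * norm T"
    by (simp add: onorm_scaleR blinfun.bounded_linear_right norm_blinfun.rep_eq)
  finally show ?thesis .
qed

lemma normed_space_over_operators:
  "normed_space_over (operator_scale scale :: 'k \<Rightarrow> ('b::real_normed_vector \<Rightarrow>\<^sub>L 'a) \<Rightarrow> _)"
  by unfold_locales
    (auto intro!: blinfun_eqI
      simp: operator_scale_apply blinfun.bilinear_simps scale_right_distrib scale_left_distrib
        scale_of_real norm_operator_scale)

end

definition dual_space ::
    "('k::real_or_complex \<Rightarrow> 'a::real_normed_vector \<Rightarrow> 'a) \<Rightarrow> ('a \<Rightarrow>\<^sub>L 'k) set" where
  "dual_space sa = bounded_operators sa (*)"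

definition dual_ball ::
    "('k::real_or_complex \<Rightarrow> 'a::real_normed_vector \<Rightarrow> 'a) \<Rightarrow> ('a \<Rightarrow>\<^sub>L 'k) set" where
  "dual_ball sa = dual_space sa \<inter> cball 0 1"

text \<open>
  Reflexivity is surjectivity of the canonical embedding into the bidual. A bidual element is a
  bounded \<open>'k\<close>-linear functional \<open>F\<close> on \<^const>\<open>dual_space\<close>; its values elsewhere on the type
  \<open>'a \<Rightarrow>\<^sub>L 'k\<close> play no role.
\<close>

definition reflexive_space ::
    "('k::real_or_complex \<Rightarrow> 'a::real_normed_vector \<Rightarrow> 'a) \<Rightarrow> bool" where
  "reflexive_space sa \<longleftrightarrow>
     (\<forall>F :: ('a \<Rightarrow>\<^sub>L 'k) \<Rightarrow> 'k.
        (\<forall>f \<in> dual_space sa. \<forall>g \<in> dual_space sa. F (f + g) = F f + F g) \<and>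
        (\<forall>c. \<forall>f \<in> dual_space sa. F (operator_scale (*) c f) = c * F f) \<and>
        (\<exists>M. \<forall>f \<in> dual_space sa. norm (F f) \<le> M * norm f)
        \<longrightarrow> (\<exists>x. \<forall>f \<in> dual_space sa. F f = blinfun_apply f x))"

definition birkhoff_orthogonal ::
    "('k \<Rightarrow> 'a \<Rightarrow> 'a) \<Rightarrow> 'a::real_normed_vector \<Rightarrow> 'a \<Rightarrow> bool" where
  "birkhoff_orthogonal s x y \<longleftrightarrow> (\<forall>c. norm (x + s c y) \<ge> norm x)"

end

theory Submission
  imports Defs
begin

text \<open>
  If \<open>0\<close> is in the convex hull, then for every scalar \<open>c\<close> some \<open>f (A x)\<close> in the set has
  \<open>Re c f (A x) \<ge> 0\<close>, and evaluating \<open>f\<close> at \<open>(T + c A) x\<close> gives \<open>\<parallel>T + c A\<parallel> \<ge> \<parallel>T\<parallel>\<close>.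

  Conversely, by reflexivity and Banach--Alaoglu both unit balls are compact in their weak
  topologies, and \<open>(x, f) \<mapsto> f (T x)\<close> is continuous on their product because \<open>T\<close> is compact. So the
  values \<open>f (A x)\<close> at pairs with \<open>f (T x) = \<parallel>T\<parallel>\<close> form a compact set; if its convex hull missed \<open>0\<close>,
  a separating direction \<open>c\<close> would contradict orthogonality. To pass to extreme points, fix \<open>x\<close>:
  the norming \<open>f\<close> form a compact face of the dual ball, and every extreme point of the image of
  this face in the scalar field lifts, by Krein--Milman in the fibre, to an extreme point of the
  ball. As the image is compact, convex and finite-dimensional, no closure of the hull is
  needed. The same argument with \<open>f\<close> fixed handles \<open>x\<close>.
\<close>

subsection \<open>The Hahn--Banach theorem\<close>

text \<open>Any element of \<open>A\<close> bounds the empty chain, so only nonempty chains remain,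
  where infima and intersections make sense. Below it is used with reversed orders to produce
  minimal elements.\<close>

lemma predicate_Zorn_nonempty:
  fixes P :: "'a \<Rightarrow> 'a \<Rightarrow> bool"
  assumes "reflp_on A P" "transp_on A P" "antisymp_on A P" and "A \<noteq> {}"
    and "\<And>C. C \<subseteq> A \<Longrightarrow> C \<noteq> {} \<Longrightarrow> (\<And>a b. a \<in> C \<Longrightarrow> b \<in> C \<Longrightarrow> P a b \<or> P b a) \<Longrightarrow> \<exists>u\<in>A. \<forall>a\<in>C. P a u"
  shows "\<exists>m\<in>A. \<forall>a\<in>A. P m a \<longrightarrow> a = m"
proof (rule predicate_Zorn)
  show "partial_order_on A (relation_of P A)"
    using assms(1-3) by (intro partial_order_on_relation_ofI) (blast dest: reflp_onD transp_onD antisymp_onD)+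
  fix C assume C: "C \<in> Chains (relation_of P A)"
  show "\<exists>u\<in>A. \<forall>a\<in>C. P a u"
  proof (cases "C = {}")
    case True then show ?thesis using assms(4) by auto
  next
    case False
    with C show ?thesis by (intro assms(5)) (auto simp: Chains_def relation_of_def)
  qed
qed

definition sublinear :: "('v::real_vector \<Rightarrow> real) \<Rightarrow> bool" where
  "sublinear p \<longleftrightarrow> (\<forall>x y. p (x + y) \<le> p x + p y) \<and> (\<forall>r\<ge>0. \<forall>x. p (r *\<^sub>R x) = r * p x)"

lemma sublinear_add: "sublinear p \<Longrightarrow> p (x + y) \<le> p x + p y"
  and sublinear_scaleR: "sublinear p \<Longrightarrow> 0 \<le> r \<Longrightarrow> p (r *\<^sub>R x) = r * p x"
  by (auto simp: sublinear_def)

text \<open>The missing inequality \<open>r * p x \<le> p (r *\<^sub>R x)\<close> is the assumed one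
  for the factor \<open>inverse r\<close> at the point \<open>r *\<^sub>R x\<close>.\<close>

lemma sublinearI:
  assumes add: "\<And>x y. p (x + y) \<le> p x + p y"
    and le: "\<And>r x. 0 < r \<Longrightarrow> p (r *\<^sub>R x) \<le> r * p x" and zero: "p 0 = 0"
  shows "sublinear p"
proof -
  have "p (r *\<^sub>R x) = r * p x" if "0 \<le> r" for r x
  proof (cases "r = 0")
    case False
    with that have "0 < r" by simp
    with le[of "inverse r" "r *\<^sub>R x"] have "r * p x \<le> p (r *\<^sub>R x)"
      by (simp add: field_simps)
    with le[OF \<open>0 < r\<close>, of x] show ?thesis by simp
  qed (simp add: zero)
  with add show ?thesis by (simp add: sublinear_def)
qed

lemma sublinear_minus: "sublinear p \<Longrightarrow> - p (- x) \<le> p x"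
  using sublinear_add[of p x "- x"] sublinear_scaleR[of p 0 0] by simp

lemma sublinear_norm: "sublinear norm"
  by (auto simp: sublinear_def norm_triangle_ineq)

text \<open>The witness is the infimum of \<open>p (x + t z) - t p z\<close> over \<open>t \<ge> 0\<close>. A minimal sublinear \<open>p\<close> thus
  satisfies \<open>p x + p z \<le> p (x + z)\<close>, which is what makes it linear.\<close>

lemma sublinear_reduce:
  assumes p: "sublinear p"
  obtains p' where "sublinear p'" "\<And>x. p' x \<le> p (x + z) - p z" "\<And>x. p' x \<le> p x"
proof -
  define a where "a x t = p (x + t *\<^sub>R z) - t * p z" for x t
  define p' where "p' x = (INF t\<in>{0..}. a x t)" for x
  \<comment> \<open>Writing \<open>t z\<close> as \<open>(x + t z) + (- x)\<close> bounds
    \<open>a x t\<close> below independently of \<open>t\<close>, so the infimum is finite.\<close>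
  have lower: "- p (- x) \<le> a x t" if "0 \<le> t" for x t
    using sublinear_add[OF p, of "x + t *\<^sub>R z" "- x"] sublinear_scaleR[OF p that, of z]
    by (simp add: a_def)
  have p'_le: "p' x \<le> a x t" if "0 \<le> t" for x t
    unfolding p'_def by (rule cINF_lower) (use that lower in \<open>auto intro!: bdd_belowI2\<close>)
  have p'_ge: "m \<le> p' x" if "\<And>t. 0 \<le> t \<Longrightarrow> m \<le> a x t" for x m
    unfolding p'_def by (rule cINF_greatest) (use that in auto)
  have p'_le_p: "p' x \<le> p x" for x
    using p'_le[of 0 x] by (simp add: a_def)
  have "p' (x + y) \<le> p' x + p' y" for x y
  proof -
    have "p' (x + y) \<le> a x s + a y t" if "0 \<le> s" "0 \<le> t" for s t
    proof -
      have "p' (x + y) \<le> a (x + y) (s + t)" using that by (intro p'_le) auto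
      also have "\<dots> \<le> a x s + a y t"
        using sublinear_add[OF p, of "x + s *\<^sub>R z" "y + t *\<^sub>R z"] by (simp add: a_def algebra_simps)
      finally show ?thesis .
    qed
    then have "p' (x + y) - a x s \<le> p' y" if "0 \<le> s" for s
      using that by (intro p'_ge) (simp add: algebra_simps)
    then have "p' (x + y) - p' y \<le> p' x"
      by (intro p'_ge) (simp add: algebra_simps)
    then show ?thesis by simp
  qed
  moreover have "p' (r *\<^sub>R x) \<le> r * p' x" if "0 < r" for r x
  proof -
    have "p' (r *\<^sub>R x) / r \<le> a x s" if "0 \<le> s" for s
    proof -
      have "p' (r *\<^sub>R x) \<le> a (r *\<^sub>R x) (r * s)" using that \<open>0 < r\<close> by (intro p'_le) auto
      also have "\<dots> = r * a x s"
        using sublinear_scaleR[OF p, of r "x + s *\<^sub>R z"] \<open>0 < r\<close> by (simp add: a_def algebra_simps)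
      finally show ?thesis using \<open>0 < r\<close> by (simp add: field_simps)
    qed
    then have "p' (r *\<^sub>R x) / r \<le> p' x" by (rule p'_ge)
    then show ?thesis using \<open>0 < r\<close> by (simp add: field_simps)
  qed
  moreover have "p' 0 = 0"
    using p'_le_p[of 0] p'_ge[of 0 0] lower[of _ 0] sublinear_scaleR[OF p, of 0 0] by force
  ultimately have "sublinear p'" by (rule sublinearI)
  moreover have "p' x \<le> p (x + z) - p z" for x
    using p'_le[of 1 x] by (simp add: a_def)
  ultimately show ?thesis using p'_le_p that by blast
qed

lemma minimal_sublinear_imp_linear:
  assumes p: "sublinear p" and min: "\<And>q. sublinear q \<Longrightarrow> q \<le> p \<Longrightarrow> q = p"
  shows "linear p"
proof
  show add: "p (x + y) = p x + p y" for x y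
  proof -
    obtain q where "sublinear q" "\<And>x. q x \<le> p (x + y) - p y" "\<And>x. q x \<le> p x"
      using sublinear_reduce[OF p] by metis
    moreover from this have "q = p" by (intro min) (auto simp: le_fun_def)
    ultimately have "p x \<le> p (x + y) - p y" by blast
    with sublinear_add[OF p, of x y] show ?thesis by simp
  qed
  have minus: "p (- x) = - p x" for x
    using add[of x "- x"] sublinear_scaleR[OF p, of 0 0] by simp
  show "p (r *\<^sub>R x) = r *\<^sub>R p x" for r x
    using sublinear_scaleR[OF p, of r x] sublinear_scaleR[OF p, of "- r" x] minus[of "r *\<^sub>R x"]
    by (cases "0 \<le> r") auto
qed

text \<open>Zorn's lemma, used downwards, gives a minimal sublinear functional below
  \<open>q\<close>, and minimality makes it linear. The pointwise infimum of a chain is finite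
  because every member is bounded below by \<open>- q (- x)\<close>.\<close>

theorem Hahn_Banach_sublinear:
  assumes q: "sublinear q"
  obtains f where "linear f" "\<And>x. f x \<le> q x"
proof -
  define A where "A = {p. sublinear p \<and> p \<le> q}"
  have "\<exists>m\<in>A. \<forall>a\<in>A. a \<le> m \<longrightarrow> a = m"
  proof (rule predicate_Zorn_nonempty[of A "\<lambda>a b. b \<le> a"])
    show "A \<noteq> {}" using q by (auto simp: A_def)
  next
    fix C assume C: "C \<subseteq> A" "C \<noteq> {}" and chain: "\<And>a b. a \<in> C \<Longrightarrow> b \<in> C \<Longrightarrow> b \<le> a \<or> a \<le> b"
    define u where "u x = (INF p\<in>C. p x)" for x
    have sub: "sublinear p" and le_q: "p x \<le> q x" if "p \<in> C" for p x
      using that C by (auto simp: A_def le_fun_def)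
    have lower: "- q (- x) \<le> p x" if "p \<in> C" for p x
      using sublinear_minus[OF sub[OF that], of x] le_q[OF that, of "- x"] by simp
    have u_le: "u x \<le> p x" if "p \<in> C" for p x
      unfolding u_def by (rule cINF_lower) (use that lower in \<open>auto intro!: bdd_belowI2\<close>)
    have u_ge: "m \<le> u x" if "\<And>p. p \<in> C \<Longrightarrow> m \<le> p x" for x m
      unfolding u_def by (rule cINF_greatest) (use that C in auto)
    have "u (x + y) \<le> u x + u y" for x y
    proof -
      have "u (x + y) \<le> p x + p' y" if *: "p \<in> C" "p' \<in> C" for p p'
      proof -
        \<comment> \<open>The smaller of the two functionals lies below both, so subadditivity of
          this single one suffices.\<close>
        obtain m where m: "m \<in> C" "m \<le> p" "m \<le> p'" using chain[OF *] * by (metis order_refl)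
        have "u (x + y) \<le> m x + m y"
          using u_le[OF m(1)] sublinear_add[OF sub[OF m(1)]] order_trans by blast
        also have "\<dots> \<le> p x + p' y" using m by (auto simp: le_fun_def intro: add_mono)
        finally show ?thesis .
      qed
      then have "u (x + y) - p x \<le> u y" if "p \<in> C" for p
        using that by (intro u_ge) (simp add: diff_le_eq add.commute[of _ "p x"])
      then have "u (x + y) - u y \<le> u x"
        by (intro u_ge) (simp add: algebra_simps)
      then show ?thesis by simp
    qed
    moreover have "u (r *\<^sub>R x) \<le> r * u x" if "0 < r" for r x
    proof -
      have "u (r *\<^sub>R x) / r \<le> p x" if "p \<in> C" for p
        using u_le[OF that, of "r *\<^sub>R x"] sublinear_scaleR[OF sub[OF that], of r x] \<open>0 < r\<close>
        by (simp add: field_simps)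
      then have "u (r *\<^sub>R x) / r \<le> u x" by (rule u_ge)
      then show ?thesis using \<open>0 < r\<close> by (simp add: field_simps)
    qed
    moreover have "u 0 = 0"
    proof -
      have zero: "p 0 = 0" if "p \<in> C" for p using sublinear_scaleR[OF sub[OF that], of 0 0] by simp
      obtain p where "p \<in> C" using C(2) by blast
      with zero u_le[of p 0] have "u 0 \<le> 0" by metis
      moreover have "0 \<le> u 0" by (rule u_ge) (metis zero order_refl)
      ultimately show ?thesis by simp
    qed
    ultimately have "sublinear u" by (rule sublinearI)
    moreover obtain p where p: "p \<in> C" using C(2) by blast
    have "u \<le> q"
    proof (rule le_funI)
      show "u x \<le> q x" for x using u_le[OF p, of x] le_q[OF p, of x] by simp
    qed
    ultimately show "\<exists>u\<in>A. \<forall>p\<in>C. u \<le> p"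
      using u_le by (auto simp: A_def le_fun_def)
  qed (auto intro!: reflp_onI transp_onI antisymp_onI)
  then obtain m where m: "m \<in> A" "\<forall>a\<in>A. a \<le> m \<longrightarrow> a = m" by blast
  have "linear m"
    by (rule minimal_sublinear_imp_linear) (use m in \<open>auto simp: A_def intro: order_trans\<close>)
  with m that show ?thesis by (auto simp: A_def le_fun_def)
qed

corollary Hahn_Banach_norming_real:
  fixes y :: "'v::real_normed_vector"
  obtains f where "linear f" "\<And>x. f x \<le> norm x" "f y = norm y"
proof -
  \<comment> \<open>Reducing the norm in direction \<open>y\<close> gives
    \<open>q (- y) \<le> - norm y\<close>. Any linear \<open>f\<close> below \<open>q\<close> then
    has \<open>f y \<ge> norm y\<close>.\<close>
  obtain q where q: "sublinear q" "\<And>x. q x \<le> norm (x + y) - norm y" "\<And>x. q x \<le> norm x"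
    using sublinear_reduce[OF sublinear_norm] by metis
  obtain f where f: "linear f" "\<And>x. f x \<le> q x" using Hahn_Banach_sublinear[OF q(1)] by metis
  have "f (- y) \<le> - norm y" using f(2)[of "- y"] q(2)[of "- y"] by simp
  then have "f y = norm y"
    using f(2)[of y] q(3)[of y] linear_neg[OF f(1), of y] by simp
  with f q(3) that show ?thesis by (meson order_trans)
qed

subsection \<open>Real or complex scalars\<close>

definition to_complex :: "'k::real_or_complex \<Rightarrow> complex" where
  "to_complex = (SOME \<phi>.
     (\<forall>x y. \<phi> (x + y) = \<phi> x + \<phi> y) \<and>
     (\<forall>x y. \<phi> (x * y) = \<phi> x * \<phi> y) \<and>
     (\<forall>r x. \<phi> (r *\<^sub>R x) = r *\<^sub>R \<phi> x) \<and>
     (\<forall>x. norm (\<phi> x) = norm x) \<and>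
     (range \<phi> = \<real> \<or> range \<phi> = UNIV))"

lemma to_complex_add: "to_complex (x + y) = to_complex x + to_complex y"
  and to_complex_mult: "to_complex (x * y) = to_complex x * to_complex y"
  and to_complex_scaleR: "to_complex (r *\<^sub>R x) = r *\<^sub>R to_complex x"
  and norm_to_complex: "norm (to_complex x) = norm x"
  and range_to_complex: "range (to_complex :: 'k \<Rightarrow> complex) = \<real> \<or> range (to_complex :: 'k \<Rightarrow> complex) = UNIV"
  for x y :: "'k::real_or_complex"
  using someI_ex[OF embedding_into_complex[where 'a='k]] unfolding to_complex_def[symmetric]
  by blast+

lemma linear_to_complex: "linear to_complex"
  by (rule linearI) (auto simp: to_complex_add to_complex_scaleR)

lemma bounded_linear_to_complex: "bounded_linear to_complex"
  by (rule bounded_linear_intro[where K = 1]) (auto simp: to_complex_add to_complex_scaleR norm_to_complex)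

lemmas tendsto_to_complex = bounded_linear.tendsto[OF bounded_linear_to_complex]

lemma to_complex_0: "to_complex 0 = 0"
  by (rule linear_0[OF linear_to_complex])

lemma to_complex_diff: "to_complex (x - y) = to_complex x - to_complex y"
  by (rule linear_diff[OF linear_to_complex])

lemma to_complex_eq_iff: "to_complex x = to_complex y \<longleftrightarrow> x = y"
  using norm_to_complex[of "x - y"] by (auto simp: to_complex_diff)

lemmas to_complex_eqI = to_complex_eq_iff[THEN iffD1]

lemma inv_to_complex: "inv to_complex (to_complex x) = x"
  by (simp add: inv_f_f inj_def to_complex_eq_iff)

lemma to_complex_1: "to_complex (1::'k::real_or_complex) = 1"
  using to_complex_mult[of "1::'k" 1] norm_to_complex[of "1::'k"] by auto

lemma to_complex_of_real: "to_complex (of_real r) = of_real r"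
  by (simp add: of_real_def to_complex_scaleR to_complex_1)

lemma to_complex_eq_of_real_iff: "to_complex z = of_real r \<longleftrightarrow> z = of_real r"
  using to_complex_eq_iff[of z "of_real r"] by (simp only: to_complex_of_real)

lemma tendsto_to_complex_iff: "((\<lambda>z. to_complex (g z)) \<longlongrightarrow> to_complex l) F \<longleftrightarrow> (g \<longlongrightarrow> l) F"
  by (simp add: tendsto_iff dist_norm norm_to_complex flip: to_complex_diff)

text \<open>Compactness is transported from the complex plane: the embedding is isometric with
  closed range, so the ball is the continuous image of a compact set under the inverse.\<close>

lemma compact_cball_scalar: "compact (cball (0::'k::real_or_complex) r)"
proof -
  have "closed (range (to_complex :: 'k \<Rightarrow> complex))"
    using range_to_complex closed_complex_Reals closed_UNIV by metis
  moreover have im: "to_complex ` cball (0::'k) r = cball 0 r \<inter> range (to_complex :: 'k \<Rightarrow> complex)"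
    by (auto simp: norm_to_complex)
  ultimately have "compact (to_complex ` cball (0::'k) r)"
    by (simp add: compact_Int_closed)
  moreover have "continuous_on (to_complex ` cball (0::'k) r) (inv to_complex :: complex \<Rightarrow> 'k)"
    by (auto simp: continuous_on_iff inv_to_complex dist_norm norm_to_complex
        simp flip: to_complex_diff)
  ultimately have "compact ((inv to_complex :: complex \<Rightarrow> 'k) ` to_complex ` cball (0::'k) r)"
    by (rule compact_continuous_image[rotated])
  then show ?thesis by (simp add: image_image inv_to_complex)
qed

text \<open>Over the reals the imaginary unit degenerates to \<open>0\<close>, so that both fields can be treated
  at once.\<close>

lemma scalar_imaginary_unit:
  obtains j :: "'k::real_or_complex"
  where "j = 0 \<or> to_complex j = \<i>" "\<forall>c. \<exists>a b. c = of_real a + j * of_real b"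
proof (cases "range (to_complex :: 'k \<Rightarrow> complex) = UNIV")
  case True
  then obtain j :: 'k where j: "to_complex j = \<i>" by (metis surjD)
  have "c = of_real (Re (to_complex c)) + j * of_real (Im (to_complex c))" for c
    by (rule to_complex_eqI)
      (simp add: j to_complex_add to_complex_mult to_complex_of_real complex_eq_iff)
  with j that show ?thesis by blast
next
  case False
  then have real: "to_complex d \<in> \<real>" for d :: 'k using range_to_complex by blast
  have "c = of_real (Re (to_complex c)) + 0 * of_real 0" for c :: 'k
    by (rule to_complex_eqI) (simp add: to_complex_of_real real)
  then show ?thesis using that by blast
qed

lemma complex_eq_of_Re_eq_norm:
  assumes "Re z = r" "cmod z \<le> r"
  shows "z = of_real r"
proof -
  have "(Re z)\<^sup>2 + (Im z)\<^sup>2 \<le> r\<^sup>2"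
    using power_mono[OF assms(2), of 2] by (simp add: cmod_power2)
  with assms(1) show ?thesis by (simp add: complex_eq_iff)
qed

text \<open>A real-linear functional on the scalars is the real part of a multiplication, by the
  conjugate of \<open>a\<close> in the complex case and by \<open>Re a\<close> in the real case.
  This turns a separating hyperplane into a scalar that orthogonality can be tested with.\<close>

lemma inner_to_complex:
  obtains c :: "'k::real_or_complex" where "\<forall>d. Re (to_complex (c * d)) = a \<bullet> to_complex d"
proof (cases "range (to_complex :: 'k \<Rightarrow> complex) = UNIV")
  case True
  then obtain c :: 'k where "to_complex c = cnj a" by (metis surjD)
  then show ?thesis by (intro that[of c]) (simp add: to_complex_mult inner_complex_def)
next
  case False
  then have "to_complex d \<in> \<real>" for d :: 'k using range_to_complex by blast
  then show ?thesis
    by (intro that[of "of_real (Re a)"])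
      (auto simp: to_complex_mult to_complex_of_real inner_complex_def complex_is_Real_iff)
qed

section \<open>Operators and norming functionals over the scalar field\<close>

lemma bounded_operators_iff:
  assumes "normed_space_over sa" "normed_space_over sb"
  shows "T \<in> bounded_operators sa sb \<longleftrightarrow> (\<forall>c x. blinfun_apply T (sa c x) = sb c (T x))"
proof -
  interpret a: normed_space_over sa by fact
  interpret b: normed_space_over sb by fact
  show ?thesis
    unfolding bounded_operators_def Vector_Spaces.linear_iff
    using a.vector_space_axioms b.vector_space_axioms by (simp add: blinfun.add_right)
qed

context normed_space_over
begin

lemma dual_space_iff: "f \<in> dual_space scale \<longleftrightarrow> (\<forall>c x. blinfun_apply f (scale c x) = c * f x)"
  unfolding dual_space_def
  by (rule bounded_operators_iff[OF normed_space_over_axioms normed_space_over_scalars])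

lemma Hahn_Banach_norming:
  obtains f where "f \<in> dual_ball scale" "blinfun_apply f y = of_real (norm y)"
proof -
  obtain j :: 'k where j: "j = 0 \<or> to_complex j = \<i>" and cart: "\<forall>c. \<exists>a b. c = of_real a + j * of_real b"
    by (rule scalar_imaginary_unit)
  have jj: "j = 0 \<or> j * j = - 1"
    using j
  proof
    assume "to_complex j = \<i>"
    then have "to_complex (j * j) = to_complex (- 1 :: 'k)"
      by (simp add: to_complex_mult linear_neg[OF linear_to_complex] to_complex_1)
    then show ?thesis by (blast dest: to_complex_eqI)
  qed simp
  obtain g where g: "linear g" "\<And>x. g x \<le> norm x" "g y = norm y"
    by (rule Hahn_Banach_norming_real) (rule that)
  \<comment> \<open>This is the usual passage from a real-linear functional to a complex-linear one
    with real part \<open>g\<close>; for \<open>j = 0\<close> it is just \<open>g\<close>.\<close>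
  define h :: "'a \<Rightarrow> 'k" where "h x = of_real (g x) - j * of_real (g (scale j x))" for x
  have h_scale: "h (scale c x) = c * h x" for c x
  proof -
    obtain a b where c: "c = of_real a + j * of_real b" using cart by metis
    have g_scale: "g (scale c x) = a * g x + b * g (scale j x)" for x
      by (simp add: c scale_left_distrib scale_of_real linear_add[OF g(1)] linear_scale[OF g(1)]
          mult.commute[of j] flip: scale_scale)
    show ?thesis
      using jj
    proof
      assume "j = 0"
      then show ?thesis using g_scale by (simp add: h_def c linear_0[OF g(1)])
    next
      assume jj: "j * j = - 1"
      have "scale j (scale c x) = scale c (scale j x)"
        by (simp add: mult.commute)
      moreover have "g (scale j (scale j x)) = - g x"
        by (simp add: jj linear_neg[OF g(1)])
      ultimately have g_j: "g (scale j (scale c x)) = a * g (scale j x) - b * g x"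
        using g_scale[of "scale j x"] by (simp only: mult_minus_right diff_conv_add_uminus)
      have j_j: "j * (j * d) = - d" for d using jj by (simp flip: mult.assoc)
      have "h (scale c x) = of_real (a * g x + b * g (scale j x)) - j * of_real (a * g (scale j x) - b * g x)"
        by (simp only: h_def g_scale g_j)
      also have "\<dots> = c * h x"
        by (simp add: h_def c algebra_simps j_j)
      finally show ?thesis .
    qed
  qed
  have h_add: "h (u + v) = h u + h v" for u v
    unfolding h_def scale_right_distrib linear_add[OF g(1)] by (simp add: algebra_simps)
  have h_real: "g x = Re (to_complex (h x))" for x
    using j by (auto simp: h_def to_complex_diff to_complex_mult to_complex_of_real to_complex_0)
  have h_norm: "norm (h x) \<le> norm x" for x
  proof (cases "h x = 0")
    case False
    \<comment> \<open>The unimodular factor \<open>u\<close> rotates \<open>h x\<close> onto the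
      nonnegative real axis, where the real bound on \<open>g\<close> applies.\<close>
    define u where "u = of_real (norm (h x)) / h x"
    have "norm (h x) = Re (to_complex (h (scale u x)))"
      using False by (simp add: h_scale u_def to_complex_of_real)
    also have "\<dots> \<le> norm (scale u x)" using g(2)[of "scale u x"] by (simp only: h_real)
    also have "\<dots> = norm x" using False by (simp add: norm_scale u_def norm_divide)
    finally show ?thesis .
  qed simp
  have "bounded_linear h"
  proof (rule bounded_linear_intro[where K = 1])
    show "h (r *\<^sub>R x) = r *\<^sub>R h x" for r x
      using h_scale[of "of_real r" x] by (simp add: scale_of_real scaleR_conv_of_real)
  qed (use h_add h_norm in auto)
  then have h: "blinfun_apply (Blinfun h) = h" by (rule bounded_linear_Blinfun_apply)
  have "norm (Blinfun h) \<le> 1" by (rule norm_blinfun_bound) (auto simp: h h_norm)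
  then have "Blinfun h \<in> dual_ball scale"
    by (simp add: dual_ball_def dual_space_iff h h_scale)
  moreover have "h y = of_real (norm y)"
  proof -
    have "Re (to_complex (h y)) = norm y" using g(3) by (simp only: h_real)
    moreover have "cmod (to_complex (h y)) \<le> norm y" using h_norm by (simp add: norm_to_complex)
    ultimately have "to_complex (h y) = of_real (norm y)" by (rule complex_eq_of_Re_eq_norm)
    then show ?thesis by (simp only: to_complex_eq_of_real_iff)
  qed
  ultimately show ?thesis using that by (simp add: h)
qed

end

subsection \<open>Extreme points of coarsely compact sets\<close>

text \<open>Compactness of \<open>S\<close> for the initial topology of the functions in \<open>L\<close>, phrased with cluster
  points of filters so that the weak topologies never have to be constructed.\<close>

definition coarsely_compact :: "('v \<Rightarrow> 'b::topological_space) set \<Rightarrow> 'v set \<Rightarrow> bool" where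
  "coarsely_compact L S \<longleftrightarrow>
     (\<forall>F. F \<noteq> bot \<longrightarrow> eventually (\<lambda>v. v \<in> S) F \<longrightarrow>
       (\<exists>G\<le>F. G \<noteq> bot \<and> (\<exists>v\<in>S. \<forall>l\<in>L. (l \<longlongrightarrow> l v) G)))"

text \<open>Every set of \<open>G\<close> meets the image of every set of \<open>F\<close>, since
  those images belong to \<open>G\<close> as well. Hence the preimages of sets of \<open>G\<close>
  are compatible with \<open>F\<close>.\<close>

lemma subfilter_lift:
  assumes "G \<le> filtermap g F" "G \<noteq> bot"
  shows "inf (filtercomap g G) F \<noteq> bot"
proof
  assume "inf (filtercomap g G) F = bot"
  then have "eventually (\<lambda>_. False) (inf (filtercomap g G) F)" by simp
  then obtain P Q where P: "eventually P G" and Q: "eventually Q F" and PQ: "\<And>z. P (g z) \<Longrightarrow> Q z \<Longrightarrow> False"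
    unfolding eventually_inf eventually_filtercomap by blast
  have "eventually (\<lambda>v. \<exists>z. g z = v \<and> Q z) (filtermap g F)"
    unfolding eventually_filtermap using Q by (rule eventually_mono) auto
  then have "eventually (\<lambda>v. \<exists>z. g z = v \<and> Q z) G" using assms(1) by (rule filter_leD[rotated])
  with P have "eventually (\<lambda>_. False) G"
    by eventually_elim (use PQ in auto)
  with assms(2) show False by (simp add: trivial_limit_def)
qed

text \<open>The refinement takes place on the index filter rather than on its image under
  \<open>g\<close>. Hence several compactness arguments can be applied in succession to different
  components of the same index.\<close>

lemma coarsely_compactE:
  assumes "coarsely_compact L S" "F \<noteq> bot" "eventually (\<lambda>z. g z \<in> S) F"
  obtains G v where "G \<le> F" "G \<noteq> bot" "v \<in> S" "\<forall>l\<in>L. ((\<lambda>z. l (g z)) \<longlongrightarrow> l v) G"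
proof -
  have "filtermap g F \<noteq> bot" "eventually (\<lambda>v. v \<in> S) (filtermap g F)"
    using assms(2,3) by (auto simp: filtermap_bot_iff eventually_filtermap)
  then obtain G v where G: "G \<le> filtermap g F" "G \<noteq> bot" "v \<in> S" "\<And>l. l \<in> L \<Longrightarrow> (l \<longlongrightarrow> l v) G"
    using assms(1) unfolding coarsely_compact_def by blast
  show ?thesis
  proof (rule that)
    show "inf (filtercomap g G) F \<le> F" by simp
    show "inf (filtercomap g G) F \<noteq> bot" using G(1,2) by (rule subfilter_lift)
    show "\<forall>l\<in>L. ((\<lambda>z. l (g z)) \<longlongrightarrow> l v) (inf (filtercomap g G) F)"
      by (intro ballI tendsto_mono[OF inf_le1]) (rule filterlim_compose[OF G(4) filterlim_filtercomap])
  qed fact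
qed

lemma coarsely_compact_vimage:
  fixes l :: "'v \<Rightarrow> 'b::topological_space"
  assumes "coarsely_compact L S" "l \<in> L" "closed C"
  shows "coarsely_compact L {v \<in> S. l v \<in> C}"
  unfolding coarsely_compact_def
proof (intro allI impI)
  fix F :: "'v filter" assume F: "F \<noteq> bot" "eventually (\<lambda>v. v \<in> {v \<in> S. l v \<in> C}) F"
  then have "eventually (\<lambda>v. v \<in> S) F" and C: "eventually (\<lambda>v. l v \<in> C) F" by (auto elim: eventually_mono)
  with assms(1) F(1) obtain G v where G: "G \<le> F" "G \<noteq> bot" "v \<in> S" "\<forall>l\<in>L. (l \<longlongrightarrow> l v) G"
    unfolding coarsely_compact_def by blast
  moreover have "l v \<in> C"
    using assms(3) filter_leD[OF G(1) C] G(2) by (rule Lim_in_closed_set) (use G(4) assms(2) in auto)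
  ultimately show "\<exists>G\<le>F. G \<noteq> bot \<and> (\<exists>v\<in>{v \<in> S. l v \<in> C}. \<forall>l\<in>L. (l \<longlongrightarrow> l v) G)" by blast
qed

text \<open>A filter on the image is lifted to \<open>S\<close> through a right inverse of
  \<open>l\<close>; the cluster point found in \<open>S\<close> is then mapped back by
  \<open>l\<close>.\<close>

lemma coarsely_compact_imp_compact_image:
  assumes "coarsely_compact L S" "l \<in> L"
  shows "compact (l ` S)"
  unfolding compact_filter
proof (intro allI impI)
  fix F assume F: "F \<noteq> bot" "eventually (\<lambda>y. y \<in> l ` S) F"
  define g where "g = inv_into S l"
  have g: "y \<in> l ` S \<Longrightarrow> g y \<in> S \<and> l (g y) = y" for y
    unfolding g_def by (simp add: inv_into_into f_inv_into_f)
  have "eventually (\<lambda>y. g y \<in> S) F" using F(2) by (rule eventually_mono) (simp add: g)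
  then obtain G v where G: "G \<le> F" "G \<noteq> bot" "v \<in> S" "((\<lambda>y. l (g y)) \<longlongrightarrow> l v) G"
    using assms(2) by (auto elim: coarsely_compactE[OF assms(1) F(1)])
  have "eventually (\<lambda>y. l (g y) = y) G"
    by (rule eventually_mono[OF filter_leD[OF G(1) F(2)]]) (simp add: g)
  then have "((\<lambda>y. y) \<longlongrightarrow> l v) G"
    using G(4) by (rule Lim_transform_eventually[rotated])
  then have "G \<le> inf (nhds (l v)) F"
    using G(1) by (simp add: filterlim_def filtermap_ident)
  with G(2,3) show "\<exists>x\<in>l ` S. inf (nhds x) F \<noteq> bot"
    by (metis bot.extremum_uniqueI imageI)
qed

text \<open>If a point of the fibre lies strictly between \<open>a\<close> and \<open>b\<close>,
  then \<open>q\<close> would lie strictly between \<open>h a\<close> and \<open>h b\<close>.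
  Extremality forces \<open>h a = h b = q\<close>.\<close>

lemma face_of_linear_vimage_extreme:
  assumes "linear h" "convex S" "q extreme_point_of h ` S"
  shows "{v \<in> S. h v = q} face_of S"
  unfolding face_of_def
proof (intro conjI ballI impI)
  have "convex (S \<inter> h -` {q})"
    using assms(1,2) by (intro convex_Int convex_linear_vimage) auto
  moreover have "S \<inter> h -` {q} = {v \<in> S. h v = q}" by auto
  ultimately show "convex {v \<in> S. h v = q}" by simp
  fix a b x assume ab: "a \<in> S" "b \<in> S" and x: "x \<in> {v \<in> S. h v = q}" and "x \<in> open_segment a b"
  then obtain t where t: "0 < t" "t < 1" "x = (1 - t) *\<^sub>R a + t *\<^sub>R b" by (auto simp: in_segment)
  with assms(1) x have q: "q = (1 - t) *\<^sub>R h a + t *\<^sub>R h b" by (auto simp: linear_add linear_scale)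
  have eq: "h a = h b"
  proof (rule ccontr)
    assume "h a \<noteq> h b"
    with t q have "q \<in> open_segment (h a) (h b)" by (auto simp: in_segment)
    with assms(3) ab show False by (auto simp: extreme_point_of_def)
  qed
  with q have "h b = q" by (simp flip: scaleR_left_distrib)
  with eq ab show "a \<in> {v \<in> S. h v = q}" "b \<in> {v \<in> S. h v = q}" by auto
qed auto

text \<open>This replaces the closedness of compact sets in a Hausdorff space. A cluster point found
  in one member must agree, under every function in \<open>L\<close>, with one found in any other
  member along a finer filter, so by separation it lies in all of them.\<close>

lemma coarsely_compact_chain:
  fixes L :: "('v \<Rightarrow> 'b::t2_space) set"
  assumes C: "C \<noteq> {}" "\<And>c. c \<in> C \<Longrightarrow> coarsely_compact L c"
    and sep: "\<And>u v. u \<in> \<Union>C \<Longrightarrow> v \<in> \<Union>C \<Longrightarrow> (\<And>l. l \<in> L \<Longrightarrow> l u = l v) \<Longrightarrow> u = v"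
  shows "coarsely_compact L (\<Inter>C)"
    and "(\<And>c. c \<in> C \<Longrightarrow> c \<noteq> {}) \<Longrightarrow> (\<And>c d. c \<in> C \<Longrightarrow> d \<in> C \<Longrightarrow> c \<subseteq> d \<or> d \<subseteq> c) \<Longrightarrow> \<Inter>C \<noteq> {}"
proof -
  have lim: "\<exists>G\<le>F. G \<noteq> bot \<and> (\<exists>v\<in>\<Inter>C. \<forall>l\<in>L. (l \<longlongrightarrow> l v) G)"
    if F: "F \<noteq> bot" "\<And>c. c \<in> C \<Longrightarrow> eventually (\<lambda>v. v \<in> c) F" for F
  proof -
    obtain c where c: "c \<in> C" using C(1) by blast
    with F C(2)[OF c] obtain G v where G: "G \<le> F" "G \<noteq> bot" "v \<in> c" "\<forall>l\<in>L. (l \<longlongrightarrow> l v) G"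
      unfolding coarsely_compact_def by blast
    have "v \<in> d" if d: "d \<in> C" for d
    proof -
      obtain H w where H: "H \<le> G" "H \<noteq> bot" "w \<in> d" "\<forall>l\<in>L. (l \<longlongrightarrow> l w) H"
        using C(2)[OF d] G(2) filter_leD[OF G(1) F(2)[OF d]] unfolding coarsely_compact_def by blast
      have "l v = l w" if "l \<in> L" for l
        using H(2) tendsto_mono[OF H(1) G(4)[rule_format, OF that]] H(4)[rule_format, OF that]
        by (rule tendsto_unique)
      with sep[of v w] c d G(3) H(3) have "v = w" by blast
      with H(3) show ?thesis by simp
    qed
    with G show ?thesis by blast
  qed
  show "coarsely_compact L (\<Inter>C)"
    unfolding coarsely_compact_def
  proof (intro allI impI)
    fix F :: "'v filter" assume F: "F \<noteq> bot" "eventually (\<lambda>v. v \<in> \<Inter>C) F"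
    show "\<exists>G\<le>F. G \<noteq> bot \<and> (\<exists>v\<in>\<Inter>C. \<forall>l\<in>L. (l \<longlongrightarrow> l v) G)"
      by (rule lim[OF F(1)]) (rule eventually_mono[OF F(2)], blast)
  qed
  assume ne: "\<And>c. c \<in> C \<Longrightarrow> c \<noteq> {}" and chain: "\<And>c d. c \<in> C \<Longrightarrow> d \<in> C \<Longrightarrow> c \<subseteq> d \<or> d \<subseteq> c"
  \<comment> \<open>The chain is a filter base with nonempty members, so \<open>F\<close> is proper,
    and a cluster point of it lies in the intersection.\<close>
  define F where "F = (INF c\<in>C. principal c)"
  have ev: "eventually P F \<longleftrightarrow> (\<exists>c\<in>C. eventually P (principal c))" for P
    unfolding F_def using C(1)
  proof (rule eventually_INF_base)
    fix c d assume "c \<in> C" "d \<in> C"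
    with chain[of c d] show "\<exists>x\<in>C. principal x \<le> inf (principal c) (principal d)"
      by (metis Int_absorb1 Int_absorb2 inf_principal order_refl)
  qed
  have "F \<noteq> bot"
    unfolding trivial_limit_def ev using ne by (auto simp: eventually_principal)
  then show "\<Inter>C \<noteq> {}"
    using lim[of F] by (force simp: ev eventually_principal)
qed

text \<open>A minimal nonempty coarsely compact face is a single point: were some \<open>l\<close>
  in \<open>L\<close> not constant on it, the fibre over an extreme point of the image under
  \<open>l\<close> would be a smaller such face. Separation then leaves one point.\<close>

theorem extreme_point_exists_coarsely_compact:
  fixes L :: "('v::real_vector \<Rightarrow> 'b::euclidean_space) set"
  assumes S: "coarsely_compact L S" "convex S" "S \<noteq> {}"
    and lin: "\<And>l. l \<in> L \<Longrightarrow> linear l"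
    and sep: "\<And>u v. u \<in> S \<Longrightarrow> v \<in> S \<Longrightarrow> (\<And>l. l \<in> L \<Longrightarrow> l u = l v) \<Longrightarrow> u = v"
  obtains v where "v extreme_point_of S"
proof -
  define A where "A = {T. T face_of S \<and> T \<noteq> {} \<and> coarsely_compact L T}"
  have "\<exists>m\<in>A. \<forall>a\<in>A. a \<subseteq> m \<longrightarrow> a = m"
  proof (rule predicate_Zorn_nonempty[of A "\<lambda>a b. b \<subseteq> a"])
    show "A \<noteq> {}" using S face_of_refl by (auto simp: A_def)
  next
    fix C assume C: "C \<subseteq> A" "C \<noteq> {}" and chain: "\<And>a b. a \<in> C \<Longrightarrow> b \<in> C \<Longrightarrow> b \<subseteq> a \<or> a \<subseteq> b"
    have cc: "coarsely_compact L c" and face: "c face_of S" and ne: "c \<noteq> {}" if "c \<in> C" for c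
      using that C(1) by (auto simp: A_def)
    have "\<Union>C \<subseteq> S" using face face_of_imp_subset by blast
    then have sep': "\<And>u v. u \<in> \<Union>C \<Longrightarrow> v \<in> \<Union>C \<Longrightarrow> (\<And>l. l \<in> L \<Longrightarrow> l u = l v) \<Longrightarrow> u = v"
      using sep by (meson subsetD)
    have "coarsely_compact L (\<Inter>C)"
      using C(2) cc sep' by (rule coarsely_compact_chain(1))
    moreover have "\<Inter>C \<noteq> {}"
      using C(2) cc sep' ne chain by (rule coarsely_compact_chain(2))
    moreover have "\<Inter>C face_of S" using C(2) face by (rule face_of_Inter)
    ultimately show "\<exists>u\<in>A. \<forall>a\<in>C. u \<subseteq> a" by (intro bexI[of _ "\<Inter>C"]) (auto simp: A_def)
  qed (auto intro!: reflp_onI transp_onI antisymp_onI)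
  then obtain m where "m \<in> A" and min: "\<And>a. a \<in> A \<Longrightarrow> a \<subseteq> m \<Longrightarrow> a = m" by blast
  then have m: "m face_of S" "m \<noteq> {}" "coarsely_compact L m" by (auto simp: A_def)
  have conv: "convex m" using m(1) by (rule face_of_imp_convex)
  have const: "l u = l v" if l: "l \<in> L" and uv: "u \<in> m" "v \<in> m" for l u v
  proof -
    have "compact (l ` m)" using m(3) l by (rule coarsely_compact_imp_compact_image)
    then obtain q where q: "q extreme_point_of l ` m"
      using extreme_point_exists_convex conv m(2) lin[OF l] convex_linear_image by (metis image_is_empty)
    have "{v \<in> m. l v = q} face_of S"
      using face_of_linear_vimage_extreme[OF lin[OF l] conv q] m(1) by (rule face_of_trans)
    moreover have "{v \<in> m. l v = q} \<noteq> {}" using q by (auto simp: extreme_point_of_def)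
    moreover have "coarsely_compact L {v \<in> m. l v = q}"
      using coarsely_compact_vimage[OF m(3) l, of "{q}"] by simp
    ultimately have "{v \<in> m. l v = q} = m" by (intro min) (auto simp: A_def)
    with uv show ?thesis by (metis (mono_tags, lifting) mem_Collect_eq)
  qed
  obtain v where v: "v \<in> m" using m(2) by blast
  have "m \<subseteq> S" using m(1) by (rule face_of_imp_subset)
  with v const sep have "m = {v}" by blast
  with m(1) that show ?thesis by (simp add: face_of_singleton)
qed

text \<open>Minkowski's theorem in the finite-dimensional image makes the hull exact, without
  closure. Each extreme point of the image has a coarsely compact face as its fibre, and an extreme
  point of a face is extreme in \<open>S\<close>.\<close>

corollary Krein_Milman_coarsely_compact_image:
  fixes L :: "('v::real_vector \<Rightarrow> 'b::euclidean_space) set"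
  assumes S: "coarsely_compact L S" "convex S"
    and lin: "\<And>l. l \<in> L \<Longrightarrow> linear l"
    and sep: "\<And>u v. u \<in> S \<Longrightarrow> v \<in> S \<Longrightarrow> (\<And>l. l \<in> L \<Longrightarrow> l u = l v) \<Longrightarrow> u = v"
    and h: "h \<in> L"
  shows "h ` S \<subseteq> convex hull (h ` {v. v extreme_point_of S})"
proof -
  have "h ` S = convex hull {q. q extreme_point_of h ` S}"
    using coarsely_compact_imp_compact_image[OF S(1) h] convex_linear_image[OF lin[OF h] S(2)]
    by (rule Krein_Milman_Minkowski)
  also have "\<dots> \<subseteq> convex hull (h ` {v. v extreme_point_of S})"
  proof (rule hull_mono, rule subsetI)
    fix q assume "q \<in> {q. q extreme_point_of h ` S}"
    then have q: "q extreme_point_of h ` S" by simp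
    define T where "T = {v \<in> S. h v = q}"
    have face: "T face_of S"
      unfolding T_def using lin[OF h] S(2) q by (rule face_of_linear_vimage_extreme)
    have cc: "coarsely_compact L T"
      using coarsely_compact_vimage[OF S(1) h, of "{q}"] by (simp add: T_def)
    have ne: "T \<noteq> {}" using q by (auto simp: extreme_point_of_def T_def)
    obtain v where v: "v extreme_point_of T"
      by (rule extreme_point_exists_coarsely_compact[OF cc face_of_imp_convex[OF face] ne lin])
        (auto simp: T_def intro: sep)
    then have "v extreme_point_of S"
      using face face_of_trans by (metis face_of_singleton)
    moreover have "h v = q" using v by (auto simp: extreme_point_of_def T_def)
    ultimately show "q \<in> h ` {v. v extreme_point_of S}" by blast
  qed
  finally show ?thesis .
qed

subsection \<open>Weak compactness\<close>

lemma compact_imp_coarsely_compact: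
  assumes "compact K" "\<And>l. l \<in> L \<Longrightarrow> continuous_on UNIV l"
  shows "coarsely_compact L K"
  unfolding coarsely_compact_def
proof (intro allI impI)
  fix F assume "F \<noteq> bot" "eventually (\<lambda>v. v \<in> K) F"
  with assms(1) obtain x where x: "x \<in> K" "inf (nhds x) F \<noteq> bot"
    unfolding compact_filter by blast
  moreover have "(l \<longlongrightarrow> l x) (inf (nhds x) F)" if "l \<in> L" for l
    using assms(2)[OF that] by (intro tendsto_mono[OF inf_le1])
      (simp add: continuous_on_def tendsto_at_iff_tendsto_nhds)
  ultimately show "\<exists>G\<le>F. G \<noteq> bot \<and> (\<exists>v\<in>K. \<forall>l\<in>L. (l \<longlongrightarrow> l v) G)"
    by (intro exI[of _ "inf (nhds x) F"]) auto
qed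

text \<open>This is Tychonoff's theorem, with the coordinate evaluations as the distinguished
  functions.\<close>

lemma coarsely_compact_PiE:
  fixes K :: "'i \<Rightarrow> 'b::topological_space set"
  assumes "\<And>i. compact (K i)"
  shows "coarsely_compact (range (\<lambda>i h. h i)) (PiE UNIV K)"
proof (rule compact_imp_coarsely_compact)
  have "compactin (product_topology (\<lambda>i. euclidean) UNIV) (PiE UNIV K)"
    using assms by (simp add: compactin_PiE)
  then show "compact (PiE UNIV K)" by (simp add: euclidean_product_topology)
qed (auto intro: continuous_on_product_coordinates)

context normed_space_over
begin

lemma dual_ballD: "f \<in> dual_ball scale \<Longrightarrow> norm (blinfun_apply f y) \<le> norm y"
  using norm_blinfun[of f y] mult_right_mono[of "norm f" 1 "norm y"] by (simp add: dual_ball_def)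

lemma dual_space_separates:
  assumes "\<And>f. f \<in> dual_space scale \<Longrightarrow> blinfun_apply f x = f y"
  shows "x = y"
proof -
  obtain f where "f \<in> dual_ball scale" "blinfun_apply f (x - y) = of_real (norm (x - y))"
    by (rule Hahn_Banach_norming)
  with assms[of f] show ?thesis by (simp add: dual_ball_def blinfun.diff_right)
qed

text \<open>The dual ball embeds into the product of the scalar balls of radius
  \<open>norm y\<close>. The linearity equations and the bound pass to pointwise limits, so the
  limit is again in the ball. Composing with \<open>to_complex\<close> puts the values in a
  Euclidean space, as the extreme-point results require.\<close>

theorem Banach_Alaoglu:
  "coarsely_compact (range (\<lambda>y f. to_complex (blinfun_apply f y))) (dual_ball scale)"
  unfolding coarsely_compact_def
proof (intro allI impI)
  fix F :: "('a \<Rightarrow>\<^sub>L 'k) filter"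
  assume F: "F \<noteq> bot" "eventually (\<lambda>f. f \<in> dual_ball scale) F"
  have "eventually (\<lambda>f. blinfun_apply f \<in> PiE UNIV (\<lambda>y. cball 0 (norm y))) F"
    using F(2) by (rule eventually_mono) (auto simp: dual_ballD)
  then obtain G h where G: "G \<le> F" "G \<noteq> bot" "h \<in> PiE UNIV (\<lambda>y. cball 0 (norm y))"
    and l: "\<forall>l \<in> range (\<lambda>i h. h i). ((\<lambda>f. l (blinfun_apply f)) \<longlongrightarrow> l h) G"
    by (rule coarsely_compactE[OF coarsely_compact_PiE[OF compact_cball_scalar] F(1)])
  have lim: "((\<lambda>f. blinfun_apply f y) \<longlongrightarrow> h y) G" for y
    using bspec[OF l rangeI[of _ y]] by simp
  have h_norm: "norm (h y) \<le> norm y" for y using G(3) by auto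
  have h_add: "h (x + y) = h x + h y" for x y
    using G(2) lim[of "x + y"] tendsto_add[OF lim[of x] lim[of y]]
    by (auto simp: blinfun.add_right intro: tendsto_unique)
  \<comment> \<open>Additivity holds for every element of the type, but homogeneity over
    \<open>'k\<close> only on \<open>dual_space\<close>, hence only eventually along
    \<open>G\<close>.\<close>
  have "eventually (\<lambda>f. f \<in> dual_space scale) G"
    using filter_leD[OF G(1) F(2)] by (rule eventually_mono) (simp add: dual_ball_def)
  then have "eventually (\<lambda>f. c * blinfun_apply f x = f (scale c x)) G" for c x
    by (rule eventually_mono) (simp add: dual_space_iff)
  from Lim_transform_eventually[OF tendsto_mult_left[OF lim] this]
  have h_scale: "h (scale c x) = c * h x" for c x
    using G(2) lim by (blast intro: tendsto_unique)
  have "bounded_linear h"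
  proof (rule bounded_linear_intro[where K = 1])
    show "h (r *\<^sub>R x) = r *\<^sub>R h x" for r x
      using h_scale[of "of_real r" x] by (simp add: scale_of_real scaleR_conv_of_real)
  qed (use h_add h_norm in auto)
  then have h: "blinfun_apply (Blinfun h) = h" by (rule bounded_linear_Blinfun_apply)
  have "norm (Blinfun h) \<le> 1" by (rule norm_blinfun_bound) (auto simp: h h_norm)
  then have "Blinfun h \<in> dual_ball scale" by (simp add: dual_ball_def dual_space_iff h h_scale)
  then show "\<exists>G\<le>F. G \<noteq> bot \<and> (\<exists>v\<in>dual_ball scale.
      \<forall>l\<in>range (\<lambda>y f. to_complex (blinfun_apply f y)). (l \<longlongrightarrow> l v) G)"
    using G lim by (intro exI[of _ G] conjI bexI[of _ "Blinfun h"]) (auto simp: h intro: tendsto_to_complex)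
qed

text \<open>Points act on functionals by evaluation, and Tychonoff's theorem gives a pointwise limit
  \<open>h\<close> of these evaluations. It is a bounded element of the bidual, so reflexivity
  represents it by a point \<open>x\<close>.\<close>

theorem reflexive_unit_ball_weakly_compact:
  assumes "reflexive_space scale"
  shows "coarsely_compact ((\<lambda>f x. to_complex (blinfun_apply f x)) ` dual_space scale) (cball 0 1)"
  unfolding coarsely_compact_def
proof (intro allI impI)
  fix F :: "'a filter"
  assume F: "F \<noteq> bot" "eventually (\<lambda>x. x \<in> cball 0 1) F"
  have "norm (blinfun_apply f x) \<le> norm f" if "norm x \<le> 1" for f :: "'a \<Rightarrow>\<^sub>L 'k" and x
    using norm_blinfun[of f x] mult_left_mono[OF that, of "norm f"] by simp
  then have "eventually (\<lambda>x. (\<lambda>f. blinfun_apply f x) \<in> PiE UNIV (\<lambda>f :: 'a \<Rightarrow>\<^sub>L 'k. cball 0 (norm f))) F"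
    using F(2) by (auto elim: eventually_mono)
  then obtain G h where G: "G \<le> F" "G \<noteq> bot" "h \<in> PiE UNIV (\<lambda>f :: 'a \<Rightarrow>\<^sub>L 'k. cball 0 (norm f))"
    and l: "\<forall>l \<in> range (\<lambda>i h. h i). ((\<lambda>x. l (\<lambda>f :: 'a \<Rightarrow>\<^sub>L 'k. blinfun_apply f x)) \<longlongrightarrow> l h) G"
    by (rule coarsely_compactE[OF coarsely_compact_PiE[OF compact_cball_scalar] F(1)])
  have lim: "((\<lambda>x. blinfun_apply f x) \<longlongrightarrow> h f) G" for f
    using bspec[OF l rangeI[of _ f]] by simp
  have h_norm: "norm (h f) \<le> norm f" for f using G(3) by auto
  have "h (f + g) = h f + h g" for f g
    using G(2) lim[of "f + g"] tendsto_add[OF lim[of f] lim[of g]]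
    by (auto simp: blinfun.add_left intro: tendsto_unique)
  moreover have "h (operator_scale (*) c f) = c * h f" for c f
  proof -
    interpret scalars: normed_space_over "(*) :: 'k \<Rightarrow> 'k \<Rightarrow> 'k" by (rule normed_space_over_scalars)
    show ?thesis
      using G(2) lim[of "operator_scale (*) c f"] tendsto_mult_left[OF lim[of f], of c]
      by (auto simp: scalars.operator_scale_apply intro: tendsto_unique)
  qed
  moreover have "\<exists>M. \<forall>f \<in> dual_space scale. norm (h f) \<le> M * norm f"
    using h_norm by (intro exI[of _ 1]) simp
  ultimately obtain x where x: "\<And>f. f \<in> dual_space scale \<Longrightarrow> h f = blinfun_apply f x"
    using assms unfolding reflexive_space_def by meson
  \<comment> \<open>A functional norming \<open>x\<close> shows that the limit stays in the ball:
    \<open>norm x = norm (h f) \<le> norm f \<le> 1\<close>.\<close>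
  obtain f where f: "f \<in> dual_ball scale" "blinfun_apply f x = of_real (norm x)"
    by (rule Hahn_Banach_norming)
  then have "norm x \<le> 1"
    using h_norm[of f] x[of f] by (simp add: dual_ball_def)
  then show "\<exists>G\<le>F. G \<noteq> bot \<and> (\<exists>v\<in>cball 0 1.
      \<forall>l\<in>(\<lambda>f x. to_complex (blinfun_apply f x)) ` dual_space scale. (l \<longlongrightarrow> l v) G)"
    using G lim by (intro exI[of _ G] conjI bexI[of _ x]) (auto simp flip: x intro: tendsto_to_complex)
qed

end

text \<open>Compact operators turn weak convergence into norm convergence along a subfilter. The
  limit can only be \<open>T x\<close>, because composing a functional on the target with
  \<open>T\<close> gives one on the domain, and functionals separate points.\<close>

lemma compact_operator_subfilter:
  fixes T :: "'x::real_normed_vector \<Rightarrow>\<^sub>L 'y::real_normed_vector"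
    and sX :: "'k::real_or_complex \<Rightarrow> 'x \<Rightarrow> 'x"
  assumes X: "normed_space_over sX" and Y: "normed_space_over sY"
    and T: "T \<in> compact_operators sX sY"
    and F: "F \<noteq> bot" "eventually (\<lambda>z. g z \<in> cball 0 1) F"
    and lim: "\<And>f. f \<in> dual_space sX \<Longrightarrow> ((\<lambda>z. blinfun_apply f (g z)) \<longlongrightarrow> blinfun_apply f x) F"
  obtains G where "G \<le> F" "G \<noteq> bot" "((\<lambda>z. blinfun_apply T (g z)) \<longlongrightarrow> T x) G"
proof -
  interpret X: normed_space_over sX by fact
  interpret Y: normed_space_over sY by fact
  have T_scale: "blinfun_apply T (sX c x) = sY c (T x)" for c x
    using T bounded_operators_iff[OF X Y] by (auto simp: compact_operators_def)
  have "compact (closure (blinfun_apply T ` cball 0 1))" using T by (simp add: compact_operators_def)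
  then have cc: "coarsely_compact {\<lambda>y. y} (closure (blinfun_apply T ` cball 0 1))"
    by (rule compact_imp_coarsely_compact) auto
  have ev: "eventually (\<lambda>z. blinfun_apply T (g z) \<in> closure (blinfun_apply T ` cball 0 1)) F"
    using F(2) by (rule eventually_mono) (rule subsetD[OF closure_subset], rule imageI)
  obtain G y where G: "G \<le> F" "G \<noteq> bot"
    and l: "\<forall>l \<in> {\<lambda>y. y}. ((\<lambda>z. l (blinfun_apply T (g z))) \<longlongrightarrow> l y) G"
    by (rule coarsely_compactE[OF cc F(1) ev])
  have G_lim: "((\<lambda>z. blinfun_apply T (g z)) \<longlongrightarrow> y) G"
    using bspec[OF l singletonI] by simp
  have "y = T x"
  proof (rule Y.dual_space_separates)
    fix f assume f: "f \<in> dual_space sY"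
    then have "f o\<^sub>L T \<in> dual_space sX"
      by (simp add: X.dual_space_iff Y.dual_space_iff T_scale)
    from tendsto_mono[OF G(1) lim[OF this]]
    have "((\<lambda>z. blinfun_apply f (T (g z))) \<longlongrightarrow> blinfun_apply f (T x)) G" by simp
    moreover have "((\<lambda>z. blinfun_apply f (T (g z))) \<longlongrightarrow> blinfun_apply f y) G"
      using G_lim by (intro blinfun.tendsto tendsto_const)
    ultimately show "blinfun_apply f y = f (T x)" using G(2) tendsto_unique by blast
  qed
  with G G_lim that show ?thesis by blast
qed

text \<open>Four successive refinements yield weak convergence of the points, pointwise convergence
  of the functionals, and norm convergence of the images under \<open>T\<close> and
  \<open>A\<close>.\<close>

lemma coarsely_compact_ball_times_dual_ball:
  fixes T A :: "'x::real_normed_vector \<Rightarrow>\<^sub>L 'y::real_normed_vector"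
    and sX :: "'k::real_or_complex \<Rightarrow> 'x \<Rightarrow> 'x"
  assumes X: "normed_space_over sX" and Y: "normed_space_over sY"
    and refl: "reflexive_space sX"
    and T: "T \<in> compact_operators sX sY" and A: "A \<in> compact_operators sX sY"
  shows "coarsely_compact {\<lambda>(x, f). blinfun_apply f (T x), \<lambda>(x, f). blinfun_apply f (A x)}
    (cball 0 1 \<times> dual_ball sY)"
  unfolding coarsely_compact_def
proof (intro allI impI)
  interpret X: normed_space_over sX by fact
  interpret Y: normed_space_over sY by fact
  fix F :: "('x \<times> ('y \<Rightarrow>\<^sub>L 'k)) filter"
  assume F: "F \<noteq> bot" "eventually (\<lambda>p. p \<in> cball 0 1 \<times> dual_ball sY) F"
  have ball: "eventually (\<lambda>p. fst p \<in> cball 0 1) F" and dual: "eventually (\<lambda>p. snd p \<in> dual_ball sY) F"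
    using F(2) by (auto elim: eventually_mono)
  obtain G1 x where G1: "G1 \<le> F" "G1 \<noteq> bot" "x \<in> cball 0 1"
    "\<forall>l \<in> (\<lambda>f x. to_complex (blinfun_apply f x)) ` dual_space sX. ((\<lambda>p. l (fst p)) \<longlongrightarrow> l x) G1"
    by (rule coarsely_compactE[OF X.reflexive_unit_ball_weakly_compact[OF refl] F(1) ball])
  obtain G2 f where G2: "G2 \<le> G1" "G2 \<noteq> bot" "f \<in> dual_ball sY"
    "\<forall>l \<in> range (\<lambda>y f. to_complex (blinfun_apply f y)). ((\<lambda>p. l (snd p)) \<longlongrightarrow> l f) G2"
    by (rule coarsely_compactE[OF Y.Banach_Alaoglu G1(2) filter_leD[OF G1(1) dual]])
  have lim_x: "((\<lambda>p. blinfun_apply g (fst p)) \<longlongrightarrow> blinfun_apply g x) G1" if "g \<in> dual_space sX" for g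
    using bspec[OF G1(4) imageI[OF that]] by (simp only: tendsto_to_complex_iff)
  have lim_f: "((\<lambda>p. blinfun_apply (snd p) y) \<longlongrightarrow> blinfun_apply f y) G2" for y
    using bspec[OF G2(4) rangeI[of _ y]] by (simp only: tendsto_to_complex_iff)
  obtain G3 where G3: "G3 \<le> G2" "G3 \<noteq> bot" "((\<lambda>p. blinfun_apply T (fst p)) \<longlongrightarrow> T x) G3"
    by (rule compact_operator_subfilter[OF X Y T G2(2)
        filter_leD[OF order_trans[OF G2(1) G1(1)] ball] tendsto_mono[OF G2(1) lim_x]])
  obtain G where G: "G \<le> G3" "G \<noteq> bot" "((\<lambda>p. blinfun_apply A (fst p)) \<longlongrightarrow> A x) G"
    by (rule compact_operator_subfilter[OF X Y A G3(2)
        filter_leD[OF order_trans[OF G3(1) order_trans[OF G2(1) G1(1)]] ball]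
        tendsto_mono[OF order_trans[OF G3(1) G2(1)] lim_x]])
  have G_F: "G \<le> F" and G_G2: "G \<le> G2" using G(1) G3(1) G2(1) G1(1) by (auto intro: order_trans)
  \<comment> \<open>Split the value at \<open>u p\<close> into those at \<open>u p - y\<close> and
    at \<open>y\<close>: the first is at most \<open>norm (u p - y)\<close> because the functionals
    have norm at most one, and the second converges pointwise.\<close>
  have lim: "((\<lambda>p. blinfun_apply (snd p) (u p)) \<longlongrightarrow> blinfun_apply f y) G" if u: "(u \<longlongrightarrow> y) G" for u y
  proof -
    have "((\<lambda>p. norm (u p - y)) \<longlongrightarrow> 0) G"
      using u by (simp add: tendsto_norm_zero_iff LIM_zero)
    then have "((\<lambda>p. blinfun_apply (snd p) (u p - y)) \<longlongrightarrow> 0) G"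
      by (rule Lim_null_comparison[rotated])
        (rule eventually_mono[OF filter_leD[OF G_F dual]], rule Y.dual_ballD)
    from tendsto_add[OF this tendsto_mono[OF G_G2 lim_f[of y]]] show ?thesis
      by (simp add: blinfun.diff_right)
  qed
  show "\<exists>G\<le>F. G \<noteq> bot \<and> (\<exists>v\<in>cball 0 1 \<times> dual_ball sY.
      \<forall>l\<in>{\<lambda>(x, f). blinfun_apply f (T x), \<lambda>(x, f). blinfun_apply f (A x)}. (l \<longlongrightarrow> l v) G)"
    using G_F G(2) G1(3) G2(3) lim[OF tendsto_mono[OF G(1) G3(3)]] lim[OF G(3)]
    by (intro exI[of _ G] conjI bexI[of _ "(x, f)"]) (auto simp: case_prod_unfold)
qed

subsection \<open>Norming extreme points\<close>

text \<open>Since \<open>cmod (k v) \<le> r\<close> on \<open>S\<close>, the equation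
  \<open>k v = of_real r\<close> says exactly that \<open>Re (k v)\<close> attains the maximal value
  \<open>r\<close>. Its solutions form a coarsely compact face, and extreme points of this face are
  extreme in \<open>S\<close>.\<close>

lemma Krein_Milman_norming_face:
  fixes L :: "('v::real_vector \<Rightarrow> complex) set"
  assumes S: "coarsely_compact L S" "convex S"
    and lin: "\<And>l. l \<in> L \<Longrightarrow> linear l"
    and sep: "\<And>u v. u \<in> S \<Longrightarrow> v \<in> S \<Longrightarrow> (\<And>l. l \<in> L \<Longrightarrow> l u = l v) \<Longrightarrow> u = v"
    and h: "h \<in> L" and k: "k \<in> L" "\<And>v. v \<in> S \<Longrightarrow> cmod (k v) \<le> r"
  shows "h ` {v \<in> S. k v = of_real r} \<subseteq> convex hull (h ` {v. v extreme_point_of S \<and> k v = of_real r})"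
proof -
  define T where "T = {v \<in> S. k v = of_real r}"
  have T_eq: "T = {v \<in> S. Re (k v) = r}"
    using complex_eq_of_Re_eq_norm k(2) by (auto simp: T_def)
  have face: "T face_of S"
  proof (cases "T = {}")
    case False
    then have "r \<in> (\<lambda>v. Re (k v)) ` S" by (auto simp: T_eq)
    moreover have "Re (k v) \<le> r" if "v \<in> S" for v
      using k(2)[OF that] complex_Re_le_cmod by (rule order_trans[rotated])
    then have "r \<notin> open_segment (Re (k u)) (Re (k v))" if "u \<in> S" "v \<in> S" for u v
      using that by (auto simp: open_segment_eq_real_ivl not_less)
    ultimately have "r extreme_point_of (\<lambda>v. Re (k v)) ` S"
      by (auto simp: extreme_point_of_def)
    moreover have "linear (\<lambda>v. Re (k v))"
      using linear_compose[OF lin[OF k(1)] bounded_linear.linear[OF bounded_linear_Re]]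
      by (simp add: o_def)
    ultimately show ?thesis
      unfolding T_eq using S(2) by (intro face_of_linear_vimage_extreme)
  qed simp
  have "coarsely_compact L T"
    using coarsely_compact_vimage[OF S(1) k(1), of "{of_real r}"] by (simp add: T_def)
  then have "h ` T \<subseteq> convex hull (h ` {v. v extreme_point_of T})"
    by (rule Krein_Milman_coarsely_compact_image[OF _ face_of_imp_convex[OF face] lin _ h])
      (auto simp: T_def intro: sep)
  also have "\<dots> \<subseteq> convex hull (h ` {v. v extreme_point_of S \<and> k v = of_real r})"
  proof (intro hull_mono image_mono subsetI CollectI conjI)
    fix v assume "v \<in> {v. v extreme_point_of T}"
    then have v: "v extreme_point_of T" by simp
    then show "v extreme_point_of S"
      using face face_of_trans by (metis face_of_singleton)
    from v show "k v = of_real r" by (simp add: extreme_point_of_def T_def)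
  qed
  finally show ?thesis by (simp add: T_def)
qed

lemma norm_blinfun_approx:
  fixes S :: "'a::real_normed_vector \<Rightarrow>\<^sub>L 'b::real_normed_vector"
  assumes "e > 0"
  obtains x where "norm x \<le> 1" "norm S - e < norm (blinfun_apply S x)"
proof (rule ccontr)
  assume "\<not> thesis"
  with that have le: "norm (blinfun_apply S x) \<le> norm S - e" if "norm x \<le> 1" for x
    using that by (meson not_le)
  have "norm S \<le> norm S - e"
  proof (rule norm_blinfun_bound)
    show "0 \<le> norm S - e" using le[of 0] by simp
    show "norm (blinfun_apply S x) \<le> (norm S - e) * norm x" for x
    proof (cases "x = 0")
      case False
      with le[of "x /\<^sub>R norm x"] show ?thesis by (simp add: blinfun.scaleR_right field_simps)
    qed simp
  qed
  with assms show False by simp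
qed

context normed_space_over
begin

lemma convex_dual_ball: "convex (dual_ball scale)"
proof -
  have "convex (dual_space scale)"
    by (auto simp: convex_def dual_space_iff blinfun.bilinear_simps algebra_simps)
  then show ?thesis unfolding dual_ball_def by (intro convex_Int convex_cball)
qed

lemma linear_to_complex_apply: "linear (\<lambda>x. to_complex (blinfun_apply f x))"
  and linear_to_complex_eval: "linear (\<lambda>f. to_complex (blinfun_apply f x))"
  by (rule linearI; simp add: blinfun.bilinear_simps to_complex_add to_complex_scaleR)+

lemma dual_ball_extreme_norming:
  assumes "f \<in> dual_ball scale" "blinfun_apply f y = of_real r" "norm y \<le> r"
  shows "to_complex (blinfun_apply f z) \<in> convex hull
    ((\<lambda>g. to_complex (blinfun_apply g z)) ` {g. g extreme_point_of dual_ball scale \<and> blinfun_apply g y = of_real r})"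
proof -
  let ?e = "\<lambda>y f. to_complex (blinfun_apply f y)"
  have "?e z ` {g \<in> dual_ball scale. ?e y g = of_real r} \<subseteq>
      convex hull (?e z ` {g. g extreme_point_of dual_ball scale \<and> ?e y g = of_real r})"
  proof (rule Krein_Milman_norming_face[OF Banach_Alaoglu convex_dual_ball])
    fix g h :: "'a \<Rightarrow>\<^sub>L 'k" assume "\<And>l. l \<in> range ?e \<Longrightarrow> l g = l h"
    then have "?e y g = ?e y h" for y by blast
    then show "g = h" by (blast intro: blinfun_eqI dest: to_complex_eqI)
  next
    show "cmod (?e y g) \<le> r" if "g \<in> dual_ball scale" for g
      using dual_ballD[OF that, of y] assms(3) by (simp add: norm_to_complex)
  qed (auto intro: linear_to_complex_eval)
  then show ?thesis
    unfolding to_complex_eq_of_real_iff by (rule subsetD) (rule imageI, simp add: assms)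
qed

lemma reflexive_ball_extreme_norming:
  assumes "reflexive_space scale" "k \<in> dual_space scale" "norm k \<le> r" "h \<in> dual_space scale"
    and "norm x \<le> 1" "blinfun_apply k x = of_real r"
  shows "to_complex (blinfun_apply h x) \<in> convex hull
    ((\<lambda>x. to_complex (blinfun_apply h x)) ` {x. x extreme_point_of cball 0 1 \<and> blinfun_apply k x = of_real r})"
proof -
  let ?e = "\<lambda>f x. to_complex (blinfun_apply f x)"
  have "?e h ` {x \<in> cball 0 1. ?e k x = of_real r} \<subseteq>
      convex hull (?e h ` {x. x extreme_point_of cball 0 1 \<and> ?e k x = of_real r})"
  proof (rule Krein_Milman_norming_face[OF reflexive_unit_ball_weakly_compact[OF assms(1)] convex_cball])
    fix x y :: 'a assume *: "\<And>l. l \<in> ?e ` dual_space scale \<Longrightarrow> l x = l y"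
    show "x = y"
      by (rule dual_space_separates) (rule to_complex_eqI, rule *[OF imageI])
  next
    fix x :: 'a assume "x \<in> cball 0 1"
    then have "norm (blinfun_apply k x) \<le> norm k * 1"
      using norm_blinfun[of k x] mult_left_mono[of "norm x" 1 "norm k"] by simp
    with assms(3) show "cmod (?e k x) \<le> r" by (simp add: norm_to_complex)
  qed (use assms in \<open>auto intro: linear_to_complex_apply\<close>)
  then show ?thesis
    unfolding to_complex_eq_of_real_iff by (rule subsetD) (rule imageI, simp add: assms)
qed

end

section \<open>Birkhoff-James orthogonality and norming pairs\<close>

lemma Re_to_complex_le: "Re (to_complex z) \<le> norm z"
  using complex_Re_le_cmod[of "to_complex z"] by (simp add: norm_to_complex)

text \<open>Take pairs \<open>(x, f)\<close> at which \<open>T + t c A\<close> almost attains its norm, with an error of order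
  \<open>t\<^sup>2\<close>: since \<open>Re f (T x) \<le> \<parallel>T\<parallel>\<close>, orthogonality forces \<open>Re c f (A x) \<ge> - t\<close>. Let \<open>t \<rightarrow> 0\<close>.\<close>

lemma Birkhoff_orthogonal_imp_norming_pair:
  fixes T A :: "'x::real_normed_vector \<Rightarrow>\<^sub>L 'y::real_normed_vector"
    and sX :: "'k::real_or_complex \<Rightarrow> 'x \<Rightarrow> 'x"
  assumes X: "normed_space_over sX" and Y: "normed_space_over sY"
    and refl: "reflexive_space sX"
    and T: "T \<in> compact_operators sX sY" and A: "A \<in> compact_operators sX sY"
    and orth: "birkhoff_orthogonal (operator_scale sY) T A"
  obtains x f where "norm x \<le> 1" "f \<in> dual_ball sY" "blinfun_apply f (T x) = of_real (norm T)"
    "0 \<le> Re (to_complex (c * blinfun_apply f (A x)))"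
proof -
  interpret X: normed_space_over sX by fact
  interpret Y: normed_space_over sY by fact
  define t where "t n = inverse (real (Suc n))" for n
  have t_pos: "t n > 0" for n by (simp add: t_def)
  have t_lim: "t \<longlonglongrightarrow> 0" unfolding t_def by (rule LIMSEQ_inverse_real_of_nat)
  define K where "K = norm c * norm A"
  let ?a = "\<lambda>(x, f). Re (to_complex (blinfun_apply f (T x)))"
  let ?b = "\<lambda>(x, f). Re (to_complex (c * blinfun_apply f (A x)))"
  have "\<exists>p \<in> cball 0 1 \<times> dual_ball sY. norm T - (t n)\<^sup>2 - t n * K \<le> ?a p \<and> - t n \<le> ?b p" for n
  proof -
    define S where "S = T + operator_scale sY (of_real (t n) * c) A"
    obtain x where x: "norm x \<le> 1" "norm S - (t n)\<^sup>2 < norm (blinfun_apply S x)"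
      using norm_blinfun_approx[of "(t n)\<^sup>2" S] t_pos[of n] by auto
    obtain f where f: "f \<in> dual_ball sY" "blinfun_apply f (S x) = of_real (norm (blinfun_apply S x))"
      by (rule Y.Hahn_Banach_norming)
    have ball: "norm (blinfun_apply f (blinfun_apply B x)) \<le> norm B" for B :: "'x \<Rightarrow>\<^sub>L 'y"
    proof -
      have "norm (blinfun_apply f (blinfun_apply B x)) \<le> norm (blinfun_apply B x)"
        using f(1) by (rule Y.dual_ballD)
      also have "\<dots> \<le> norm B * norm x" by (rule norm_blinfun)
      also have "\<dots> \<le> norm B" using mult_left_mono[OF x(1), of "norm B"] by simp
      finally show ?thesis .
    qed
    have "blinfun_apply f (S x) = f (T x) + t n *\<^sub>R (c * f (A x))"
      using f(1) by (simp add: S_def blinfun.add_left blinfun.add_right Y.operator_scale_apply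
          dual_ball_def Y.dual_space_iff scaleR_conv_of_real mult.assoc)
    then have "Re (to_complex (blinfun_apply f (S x))) = ?a (x, f) + t n * ?b (x, f)"
      by (simp add: to_complex_add to_complex_scaleR)
    then have "norm (blinfun_apply S x) = ?a (x, f) + t n * ?b (x, f)"
      by (simp add: f(2) to_complex_of_real)
    moreover have "norm T \<le> norm S"
      using orth by (simp add: birkhoff_orthogonal_def S_def)
    ultimately have *: "norm T - (t n)\<^sup>2 \<le> ?a (x, f) + t n * ?b (x, f)" using x(2) by linarith
    have "?a (x, f) \<le> norm T" using order_trans[OF Re_to_complex_le ball] by simp
    with * have "- (t n * t n) \<le> t n * ?b (x, f)" by (simp add: power2_eq_square)
    then have "t n * (- t n) \<le> t n * ?b (x, f)" by simp
    then have "- t n \<le> ?b (x, f)" using t_pos[of n] by (simp only: mult_le_cancel_left_pos)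
    \<comment> \<open>An upper bound on \<open>?b\<close> is needed to read the same estimate as a
      lower bound on \<open>?a\<close> that tends to \<open>norm T\<close>.\<close>
    moreover have "?b (x, f) \<le> K"
    proof -
      have "?b (x, f) \<le> norm (c * blinfun_apply f (A x))" using Re_to_complex_le by simp
      also have "\<dots> \<le> K" unfolding K_def norm_mult using ball by (intro mult_left_mono) auto
      finally show ?thesis .
    qed
    then have "t n * ?b (x, f) \<le> t n * K" using t_pos[of n] by (intro mult_left_mono) auto
    with * have "norm T - (t n)\<^sup>2 - t n * K \<le> ?a (x, f)" by linarith
    ultimately show ?thesis using x(1) f(1) by (intro bexI[of _ "(x, f)"]) auto
  qed
  then obtain p where p: "\<And>n. p n \<in> cball 0 1 \<times> dual_ball sY"
    "\<And>n. norm T - (t n)\<^sup>2 - t n * K \<le> ?a (p n)" "\<And>n. - t n \<le> ?b (p n)"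
    by metis
  obtain G q where G: "G \<le> sequentially" "G \<noteq> bot" "q \<in> cball 0 1 \<times> dual_ball sY"
    "\<forall>l\<in>{\<lambda>(x, f). blinfun_apply f (T x), \<lambda>(x, f). blinfun_apply f (A x)}.
      ((\<lambda>n. l (p n)) \<longlongrightarrow> l q) G"
    by (rule coarsely_compactE[OF coarsely_compact_ball_times_dual_ball[OF X Y refl T A]
        sequentially_bot always_eventually[OF allI[OF p(1)]]])
  obtain x f where q: "q = (x, f)" by (cases q)
  have T_lim: "((\<lambda>n. ?a (p n)) \<longlongrightarrow> ?a q) G"
    using tendsto_Re[OF tendsto_to_complex[OF bspec[OF G(4) insertI1]]] by (simp add: case_prod_unfold)
  have A_lim: "((\<lambda>n. ?b (p n)) \<longlongrightarrow> ?b q) G"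
    using tendsto_Re[OF tendsto_to_complex[OF tendsto_mult_left[OF bspec[OF G(4) insertI2[OF singletonI]]]]]
    by (simp add: case_prod_unfold)
  have tG: "(t \<longlongrightarrow> 0) G" using G(1) t_lim by (rule tendsto_mono)
  have "((\<lambda>n. norm T - (t n)\<^sup>2 - t n * K) \<longlongrightarrow> norm T - 0\<^sup>2 - 0 * K) G"
    by (intro tendsto_intros tG)
  then have "norm T \<le> ?a q"
    using tendsto_le[OF G(2) T_lim _ always_eventually[OF allI[OF p(2)]]] by simp
  moreover have "0 \<le> ?b q"
    using tendsto_le[OF G(2) A_lim _ always_eventually[OF allI[OF p(3)]], of "- 0"] tendsto_minus[OF tG]
    by simp
  \<comment> \<open>Together with \<open>norm T \<le> ?a q\<close> this forces the value of
    \<open>f\<close> at \<open>T x\<close> to be real and equal to \<open>norm T\<close>.\<close>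
  moreover have "norm (blinfun_apply f (T x)) \<le> norm T"
  proof -
    have "norm (blinfun_apply f (T x)) \<le> norm (blinfun_apply T x)"
      using G(3) by (intro Y.dual_ballD) (simp add: q)
    also have "\<dots> \<le> norm T * norm x" by (rule norm_blinfun)
    also have "\<dots> \<le> norm T" using G(3) mult_left_mono[of "norm x" 1 "norm T"] by (simp add: q)
    finally show ?thesis .
  qed
  ultimately have "to_complex (blinfun_apply f (T x)) = of_real (norm T)"
    using complex_Re_le_cmod[of "to_complex (blinfun_apply f (T x))"]
    by (intro complex_eq_of_Re_eq_norm) (auto simp: q norm_to_complex)
  then have "blinfun_apply f (T x) = of_real (norm T)"
    by (simp only: to_complex_eq_of_real_iff)
  then show ?thesis by (rule that[rotated 2]) (use \<open>0 \<le> ?b q\<close> G(3) in \<open>auto simp: q\<close>)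
qed

theorem corollary3p11:
  fixes sX :: "'k::real_or_complex \<Rightarrow> 'x::banach \<Rightarrow> 'x"
    and sY :: "'k \<Rightarrow> 'y::banach \<Rightarrow> 'y"
    and T A :: "'x \<Rightarrow>\<^sub>L 'y"
  assumes "normed_space_over sX" and "normed_space_over sY"
    and "reflexive_space sX"
    and "T \<in> compact_operators sX sY" and "A \<in> compact_operators sX sY"
  shows "birkhoff_orthogonal (operator_scale sY) T A \<longleftrightarrow>
    0 \<in> convex hull {blinfun_apply f (A x) | x f.
          x extreme_point_of cball 0 1 \<and> f extreme_point_of dual_ball sY \<and>
          blinfun_apply f (T x) = of_real (norm T)}"
    (is "?orth \<longleftrightarrow> 0 \<in> convex hull ?D")
proof
  interpret X: normed_space_over sX by fact
  interpret Y: normed_space_over sY by fact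
  {
    assume zero: "0 \<in> convex hull ?D"
    show ?orth
      unfolding birkhoff_orthogonal_def
    proof
      fix c
      \<comment> \<open>Otherwise \<open>?D\<close>, and with it its convex hull, would lie in an
        open half-space that omits 0.\<close>
      have "\<exists>d\<in>?D. 0 \<le> Re (to_complex (c * d))"
      proof (rule ccontr)
        assume "\<not> ?thesis"
        then have "?D \<subseteq> (\<lambda>d. Re (to_complex (c * d))) -` {..<0}" by (auto simp: not_le)
        moreover have "linear (\<lambda>d. Re (to_complex (c * d)))"
          by (rule linearI) (auto simp: distrib_left to_complex_add to_complex_scaleR)
        then have "convex ((\<lambda>d. Re (to_complex (c * d))) -` {..<0})"
          by (rule convex_linear_vimage) simp
        ultimately have "convex hull ?D \<subseteq> (\<lambda>d. Re (to_complex (c * d))) -` {..<0}"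
          by (rule hull_minimal)
        with zero show False by (auto simp: to_complex_0)
      qed
      then obtain x f where x: "x extreme_point_of cball 0 1" and f: "f extreme_point_of dual_ball sY"
        and fT: "blinfun_apply f (T x) = of_real (norm T)" and fA: "0 \<le> Re (to_complex (c * blinfun_apply f (A x)))"
        by blast
      let ?S = "T + operator_scale sY c A"
      have f': "f \<in> dual_ball sY" and x': "norm x \<le> 1"
        using x f by (auto simp: extreme_point_of_def)
      have "blinfun_apply f (blinfun_apply ?S x) = of_real (norm T) + c * f (A x)"
        using f' by (simp add: blinfun.add_left blinfun.add_right Y.operator_scale_apply fT
            dual_ball_def Y.dual_space_iff)
      then have "norm T \<le> Re (to_complex (blinfun_apply f (blinfun_apply ?S x)))"
        using fA by (simp add: to_complex_add to_complex_of_real)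
      also have "\<dots> \<le> norm (blinfun_apply f (blinfun_apply ?S x))" by (rule Re_to_complex_le)
      also have "\<dots> \<le> norm (blinfun_apply ?S x)" using f' by (rule Y.dual_ballD)
      also have "\<dots> \<le> norm ?S * norm x" by (rule norm_blinfun)
      also have "\<dots> \<le> norm ?S" using mult_left_mono[OF x', of "norm ?S"] by simp
      finally show "norm T \<le> norm ?S" .
    qed
  }
  assume orth: ?orth
  define M where "M = {p \<in> cball 0 1 \<times> dual_ball sY. (\<lambda>(x, f). blinfun_apply f (T x)) p \<in> {of_real (norm T)}}"
  define E where "E = (\<lambda>(x, f). blinfun_apply f (A x)) ` M"
  have "compact E"
    unfolding E_def M_def
    by (rule coarsely_compact_imp_compact_image[OF coarsely_compact_vimage[OF
        coarsely_compact_ball_times_dual_ball[OF assms]]]) auto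
  then have comp: "compact (to_complex ` E)"
    by (intro compact_continuous_image linear_continuous_on bounded_linear_to_complex)
  have "0 \<in> convex hull (to_complex ` E)"
  proof (rule ccontr)
    assume "0 \<notin> convex hull (to_complex ` E)"
    with separating_hyperplane_closed_0[OF convex_convex_hull compact_imp_closed[OF compact_convex_hull[OF comp]]]
    obtain a b where ab: "0 < b" "\<And>z. z \<in> convex hull (to_complex ` E) \<Longrightarrow> b < a \<bullet> z" by blast
    \<comment> \<open>The sign is chosen so that \<open>Re (to_complex (c * d))\<close> is negative
      on all of \<open>E\<close>, against the norming pair that orthogonality supplies for this
      \<open>c\<close>.\<close>
    obtain c :: 'k where c: "\<forall>d. Re (to_complex (c * d)) = (- a) \<bullet> to_complex d"
      by (rule inner_to_complex)
    obtain x f where "norm x \<le> 1" "f \<in> dual_ball sY" "blinfun_apply f (T x) = of_real (norm T)"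
      and neg: "0 \<le> Re (to_complex (c * blinfun_apply f (A x)))"
      by (rule Birkhoff_orthogonal_imp_norming_pair[OF assms orth])
    then have "blinfun_apply f (A x) \<in> E" by (force simp: E_def M_def)
    then have "b < a \<bullet> to_complex (blinfun_apply f (A x))" by (intro ab(2) hull_inc imageI)
    with neg ab(1) show False by (simp add: c)
  qed
  also have "convex hull (to_complex ` E) \<subseteq> convex hull (to_complex ` ?D)"
  proof (rule hull_minimal)
    have "to_complex (blinfun_apply f (A x)) \<in> convex hull (to_complex ` ?D)"
      if x: "norm x \<le> 1" and f: "f \<in> dual_ball sY" and fT: "blinfun_apply f (T x) = of_real (norm T)" for x f
    proof -
      have "norm (blinfun_apply T x) \<le> norm T"
        using norm_blinfun[of T x] mult_left_mono[OF x, of "norm T"] by simp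
      \<comment> \<open>First \<open>f\<close> is replaced by extreme functionals \<open>g\<close>
        with \<open>x\<close> fixed. These still satisfy \<open>g (T x) = norm T\<close>, so
        \<open>x\<close> can then be replaced by extreme points with \<open>g\<close> fixed, through
        the functionals \<open>g o\<^sub>L T\<close> and \<open>g o\<^sub>L A\<close>.\<close>
      from Y.dual_ball_extreme_norming[OF f fT this, of "A x"] show ?thesis
      proof (rule rev_subsetD, intro hull_minimal convex_convex_hull image_subsetI)
        fix g assume "g \<in> {g. g extreme_point_of dual_ball sY \<and> blinfun_apply g (T x) = of_real (norm T)}"
        then have g: "g extreme_point_of dual_ball sY" "blinfun_apply g (T x) = of_real (norm T)" by auto
        then have g': "g \<in> dual_space sY" "norm g \<le> 1"
          by (auto simp: extreme_point_of_def dual_ball_def)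
        have comp: "g o\<^sub>L B \<in> dual_space sX" if "B \<in> compact_operators sX sY" for B
          using that g'(1) bounded_operators_iff[OF assms(1,2)]
          by (auto simp: X.dual_space_iff Y.dual_space_iff compact_operators_def)
        have "norm (g o\<^sub>L T) \<le> norm g * norm T" by (rule norm_blinfun_compose)
        also have "\<dots> \<le> norm T" using mult_right_mono[OF g'(2), of "norm T"] by simp
        finally have "to_complex (blinfun_apply (g o\<^sub>L A) x) \<in> convex hull
          ((\<lambda>x. to_complex (blinfun_apply (g o\<^sub>L A) x)) `
            {x. x extreme_point_of cball 0 1 \<and> blinfun_apply (g o\<^sub>L T) x = of_real (norm T)})"
          using g(2) x
          by (intro X.reflexive_ball_extreme_norming[OF assms(3) comp[OF assms(4)] _ comp[OF assms(5)]]) auto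
        also have "\<dots> \<subseteq> convex hull (to_complex ` ?D)"
          using g(1) by (intro hull_mono) auto
        finally show "to_complex (blinfun_apply g (A x)) \<in> convex hull (to_complex ` ?D)" by simp
      qed
    qed
    then show "to_complex ` E \<subseteq> convex hull (to_complex ` ?D)" by (auto simp: E_def M_def)
  qed (rule convex_convex_hull)
  \<comment> \<open>Linear maps commute with convex hulls, so 0 is the image of some
    \<open>d\<close> in the hull of \<open>?D\<close>; as the embedding preserves norms,
    \<open>d = 0\<close>.\<close>
  also have "\<dots> = to_complex ` (convex hull ?D)"
    by (rule convex_hull_linear_image[OF linear_to_complex, symmetric])
  finally obtain d where d: "d \<in> convex hull ?D" "to_complex d = 0" by auto
  then have "norm d = 0" using norm_to_complex[of d] by simp
  with d(1) show "0 \<in> convex hull ?D" by simp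
qed

end
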